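(* Let $t\ge 3$ be an integer, $G=(V,E)$ a simple undirected graph in which every vertex has degree at least $1$ and at most $t+1$, and $w:E\to\mathbb{R}_{\ge 0}$ a weight function that is vertex-induced on every $K_{t+1}$ and every $K_{t,t}$ of $G$. Assume that the forbidden subgraphs of $G$ (its $K_{t+1}$'s and $K_{t,t}$'s) are pairwise vertex-disjoint, and let $G'=(V',E')$, $w'$, $l$, $b$ be as constructed below. Then for every $(l,b)$-matching $M'$ of $G'$ there exists a covering co-$t$-matching $\bar M$ of $G$ with $w(\bar M)\le w'(M')$.
   Context: A "$K_{t+1}$ of $G$" (resp. "$K_{t,t}$ of $G$") is a subgraph of $G$, not necessarily induced, isomorphic to the complete graph on $t+1$ vertices (resp. to the complete bipartite graph with color classes $V_1(H),V_2(H)$ of size $t$). $w$ is vertex-induced on a subgraph $H$ if there is $r_H:V(H)\to\mathbb{R}$ (a potential function) with $w(u,v)=r_H(u)+r_H(v)$ for every edge $(u,v)$ of $H$. A set $\bar M\subseteq E$ is a co-$t$-matching if $E\setminus\bar M$ is a $t$-matching (every vertex incident to at most $t$ of its edges); it is covering if moreover $E\setminus\bar M$ contains the edge set of no $K_{t+1}$ and no $K_{t,t}$ of $G$. Construction: start with $G'=G$, $w'(e)=w(e)$ for $e\in E$; for each vertex $v$ of $G$ set the capacity interval $[l(v),b(v)]=[1,t+1]$ if $\deg_G(v)=t+1$ and $[0,\deg_G(v)]$ otherwise. For each $K_{t+1}$ $H$ of $G$, with a fixed potential function $r_H$, add a new vertex $u_H$ with capacity interval $[2,2]$ and, for each vertex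 $v$ of $H$, an edge $(v,u_H)$ of weight $r_H(v)$. For each $K_{t,t}$ $H$ of $G$, with a fixed potential function $r_H$, add new vertices $u^1_H,u^2_H$ with capacity intervals $[1,1]$, and edges $(v,u^i_H)$ of weight $r_H(v)$ for every $v\in V_i(H)$, $i=1,2$. An $(l,b)$-matching of $G'$ is a set $M'\subseteq E'$ with $l(v)\le \deg_{M'}(v)\le b(v)$ for all $v\in V'$; $w'(M')$ is the sum of weights of its edges. *)

theory Defs
  imports Complex_Main
begin

datatype 'v ugraph = UGraph (verts: "'v set") (edges: "'v set set")

definition simple_graph :: "'v ugraph \<Rightarrow> bool" where
  "simple_graph G \<longleftrightarrow> finite (verts G) \<and> (\<forall>e \<in> edges G. e \<subseteq> verts G \<and> card e = 2)"

definition degree :: "'v set set \<Rightarrow> 'v \<Rightarrow> nat" where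
  "degree F v = card {e \<in> F. v \<in> e}"

definition subgraph :: "'v ugraph \<Rightarrow> 'v ugraph \<Rightarrow> bool" where
  "subgraph H G \<longleftrightarrow> verts H \<subseteq> verts G \<and> edges H \<subseteq> edges G"

definition complete_graph :: "nat \<Rightarrow> 'v ugraph \<Rightarrow> bool" where
  "complete_graph n H \<longleftrightarrow>
     finite (verts H) \<and> card (verts H) = n \<and> edges H = {e. e \<subseteq> verts H \<and> card e = 2}"

definition complete_bipartite :: "nat \<Rightarrow> 'v ugraph \<Rightarrow> 'v set \<Rightarrow> 'v set \<Rightarrow> bool" where
  "complete_bipartite n H A B \<longleftrightarrow>
     finite A \<and> finite B \<and> card A = n \<and> card B = n \<and> A \<inter> B = {} \<and>
     verts H = A \<union> B \<and> edges H = {{a, b} | a b. a \<in> A \<and> b \<in> B}"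

text \<open>Subgraphs are pairs of a vertex set and an edge set, so interchanging the two colour
  classes does not give a second \<open>K\<^sub>t\<^sub>,\<^sub>t\<close>, while different \<open>K\<^sub>t\<^sub>,\<^sub>t\<close>'s on the same vertex set are
  distinguished.\<close>

definition cliques :: "nat \<Rightarrow> 'v ugraph \<Rightarrow> 'v ugraph set" where
  "cliques t G = {H. subgraph H G \<and> complete_graph (t + 1) H}"

definition bicliques :: "nat \<Rightarrow> 'v ugraph \<Rightarrow> 'v ugraph set" where
  "bicliques t G = {H. subgraph H G \<and> (\<exists>A B. complete_bipartite t H A B)}"

definition forbidden :: "nat \<Rightarrow> 'v ugraph \<Rightarrow> 'v ugraph set" where
  "forbidden t G = cliques t G \<union> bicliques t G"

definition potential :: "('v set \<Rightarrow> real) \<Rightarrow> 'v ugraph \<Rightarrow> ('v \<Rightarrow> real) \<Rightarrow> bool" where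
  "potential w H \<rho> \<longleftrightarrow> (\<forall>u v. {u, v} \<in> edges H \<longrightarrow> w {u, v} = \<rho> u + \<rho> v)"

definition vertex_induced :: "('v set \<Rightarrow> real) \<Rightarrow> 'v ugraph \<Rightarrow> bool" where
  "vertex_induced w H \<longleftrightarrow> (\<exists>\<rho>. potential w H \<rho>)"

definition t_matching :: "nat \<Rightarrow> 'v ugraph \<Rightarrow> 'v set set \<Rightarrow> bool" where
  "t_matching t G M \<longleftrightarrow> M \<subseteq> edges G \<and> (\<forall>v \<in> verts G. degree M v \<le> t)"

definition co_t_matching :: "nat \<Rightarrow> 'v ugraph \<Rightarrow> 'v set set \<Rightarrow> bool" where
  "co_t_matching t G M \<longleftrightarrow> M \<subseteq> edges G \<and> t_matching t G (edges G - M)"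

definition covering_co_t_matching :: "nat \<Rightarrow> 'v ugraph \<Rightarrow> 'v set set \<Rightarrow> bool" where
  "covering_co_t_matching t G M \<longleftrightarrow>
     co_t_matching t G M \<and> (\<forall>H \<in> forbidden t G. \<not> edges H \<subseteq> edges G - M)"

definition lb_matching :: "'v ugraph \<Rightarrow> ('v \<Rightarrow> nat) \<Rightarrow> ('v \<Rightarrow> nat) \<Rightarrow> 'v set set \<Rightarrow> bool" where
  "lb_matching G l b M \<longleftrightarrow>
     M \<subseteq> edges G \<and> (\<forall>v \<in> verts G. l v \<le> degree M v \<and> degree M v \<le> b v)"

text \<open>Vertices of the auxiliary graph: \<open>CliqueV H\<close> is \<open>u\<^sub>H\<close> for a \<open>K\<^sub>t\<^sub>+\<^sub>1\<close> \<open>H\<close>, and \<open>BicliqueV1 H\<close>,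
  \<open>BicliqueV2 H\<close> are the two new vertices of a \<open>K\<^sub>t\<^sub>,\<^sub>t\<close> \<open>H\<close>.\<close>

datatype 'v aux_vertex =
    Orig 'v
  | CliqueV "'v ugraph"
  | BicliqueV1 "'v ugraph"
  | BicliqueV2 "'v ugraph"

text \<open>The parameters \<open>V1\<close> and \<open>V2\<close> name the two colour classes of each \<open>K\<^sub>t\<^sub>,\<^sub>t\<close>.\<close>

definition aux_graph ::
    "nat \<Rightarrow> 'v ugraph \<Rightarrow> ('v ugraph \<Rightarrow> 'v set) \<Rightarrow> ('v ugraph \<Rightarrow> 'v set) \<Rightarrow> 'v aux_vertex ugraph" where
  "aux_graph t G V1 V2 = UGraph
     (Orig ` verts G \<union> CliqueV ` cliques t G
        \<union> BicliqueV1 ` bicliques t G \<union> BicliqueV2 ` bicliques t G)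
     ({Orig ` e | e. e \<in> edges G}
        \<union> {{Orig v, CliqueV H} | v H. H \<in> cliques t G \<and> v \<in> verts H}
        \<union> {{Orig v, BicliqueV1 H} | v H. H \<in> bicliques t G \<and> v \<in> V1 H}
        \<union> {{Orig v, BicliqueV2 H} | v H. H \<in> bicliques t G \<and> v \<in> V2 H})"

text \<open>An auxiliary edge is either \<open>Orig ` e\<close> or of the form \<open>{Orig v, x}\<close> with \<open>x\<close> a new vertex
  of \<open>H\<close>. The values on these are computed in the two lemmas below.\<close>

definition aux_weight ::
    "('v set \<Rightarrow> real) \<Rightarrow> ('v ugraph \<Rightarrow> 'v \<Rightarrow> real) \<Rightarrow> 'v aux_vertex set \<Rightarrow> real" where
  "aux_weight w r e =
     (if e \<subseteq> range Orig then w (Orig -` e)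
      else r (THE H. CliqueV H \<in> e \<or> BicliqueV1 H \<in> e \<or> BicliqueV2 H \<in> e) (THE v. Orig v \<in> e))"

lemma aux_weight_Orig: "aux_weight w r (Orig ` e) = w e"
proof -
  have "Orig -` Orig ` e = e" by auto
  then show ?thesis by (auto simp: aux_weight_def)
qed

lemma aux_weight_new:
  "aux_weight w r {Orig v, CliqueV H} = r H v"
  "aux_weight w r {Orig v, BicliqueV1 H} = r H v"
  "aux_weight w r {Orig v, BicliqueV2 H} = r H v"
  by (auto simp: aux_weight_def)

fun lower_cap :: "nat \<Rightarrow> 'v ugraph \<Rightarrow> 'v aux_vertex \<Rightarrow> nat" where
  "lower_cap t G (Orig v) = (if degree (edges G) v = t + 1 then 1 else 0)"
| "lower_cap t G (CliqueV H) = 2"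
| "lower_cap t G (BicliqueV1 H) = 1"
| "lower_cap t G (BicliqueV2 H) = 1"

fun upper_cap :: "nat \<Rightarrow> 'v ugraph \<Rightarrow> 'v aux_vertex \<Rightarrow> nat" where
  "upper_cap t G (Orig v) = (if degree (edges G) v = t + 1 then t + 1 else degree (edges G) v)"
| "upper_cap t G (CliqueV H) = 2"
| "upper_cap t G (BicliqueV1 H) = 1"
| "upper_cap t G (BicliqueV2 H) = 1"

end

theory Submission
  imports Defs
begin

text \<open>The gadget of a forbidden subgraph \<open>H\<close> carries exactly two edges of the auxiliary matching
  \<open>M'\<close>, and these end in adjacent vertices \<open>x\<close>, \<open>y\<close> of \<open>H\<close>; since \<open>r H\<close> is a potential, their total
  weight is \<open>w {x, y}\<close>. Replacing the two edges by \<open>{x, y}\<close> for every \<open>H\<close> hits every forbidden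
  subgraph and leaves no vertex uncovered. Edges that are chosen repeatedly only make the result
  lighter, because \<open>w\<close> is nonnegative.\<close>

definition gadget_edges :: "'v aux_vertex set set \<Rightarrow> 'v ugraph \<Rightarrow> 'v aux_vertex set set" where
  "gadget_edges M' H = {e \<in> M'. CliqueV H \<in> e \<or> BicliqueV1 H \<in> e \<or> BicliqueV2 H \<in> e}"

section \<open>Finiteness of the edge set and of the forbidden subgraphs\<close>

lemma finite_edges: "simple_graph G \<Longrightarrow> finite (edges G)"
  unfolding simple_graph_def by (rule finite_subset[of _ "Pow (verts G)"]) auto

lemma finite_forbidden:
  assumes "simple_graph G"
  shows "finite (forbidden t G)"
proof (rule finite_subset)
  show "forbidden t G \<subseteq> (\<lambda>(V, E). UGraph V E) ` (Pow (verts G) \<times> Pow (edges G))"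
  proof
    fix H assume "H \<in> forbidden t G"
    then have "subgraph H G"
      by (auto simp: forbidden_def cliques_def bicliques_def)
    then show "H \<in> (\<lambda>(V, E). UGraph V E) ` (Pow (verts G) \<times> Pow (edges G))"
      by (intro image_eqI[of _ _ "(verts H, edges H)"]) (auto simp: subgraph_def)
  qed
  show "finite ((\<lambda>(V, E). UGraph V E) ` (Pow (verts G) \<times> Pow (edges G)))"
    using assms finite_edges[OF assms] by (simp add: simple_graph_def)
qed

section \<open>The gadget of a single forbidden subgraph\<close>

lemma cliques_disjoint_bicliques:
  assumes "t \<ge> 2" "H \<in> cliques t G"
  shows "H \<notin> bicliques t G"
proof
  assume "H \<in> bicliques t G"
  then obtain A B where "complete_bipartite t H A B"
    by (auto simp: bicliques_def)
  \<comment> \<open>The two kinds are told apart by their vertex counts, \<open>2 * t\<close> and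
    \<open>t + 1\<close>, which differ once \<open>t \<ge> 2\<close>.\<close>
  then have "card (verts H) = t + t"
    by (auto simp: complete_bipartite_def card_Un_disjoint)
  moreover have "card (verts H) = t + 1"
    using assms by (simp add: cliques_def complete_graph_def)
  ultimately show False using assms by simp
qed

lemma aux_edge_cases:
  assumes "e \<in> edges (aux_graph t G V1 V2)"
  obtains (orig) e' where "e' \<in> edges G" "e = Orig ` e'"
  | (clique) v H where "H \<in> cliques t G" "v \<in> verts H" "e = {Orig v, CliqueV H}"
  | (biclique1) v H where "H \<in> bicliques t G" "v \<in> V1 H" "e = {Orig v, BicliqueV1 H}"
  | (biclique2) v H where "H \<in> bicliques t G" "v \<in> V2 H" "e = {Orig v, BicliqueV2 H}"
  using assms unfolding aux_graph_def by auto

text \<open>The capacity interval \<open>[2,2]\<close> leaves exactly two matching edges at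
  \<open>CliqueV H\<close>. Being distinct, they have distinct ends in \<open>H\<close>, and any two
  distinct vertices of a complete graph are adjacent.\<close>

lemma clique_gadget:
  assumes t: "t \<ge> 2"
    and M': "lb_matching (aux_graph t G V1 V2) (lower_cap t G) (upper_cap t G) M'"
    and H: "H \<in> cliques t G"
  obtains x y where "x \<noteq> y" "{x, y} \<in> edges H"
    "gadget_edges M' H = {{Orig x, CliqueV H}, {Orig y, CliqueV H}}"
proof -
  have sub: "M' \<subseteq> edges (aux_graph t G V1 V2)"
    using M' by (simp add: lb_matching_def)
  have form: "\<exists>v\<in>verts H. e = {Orig v, CliqueV H}" if "e \<in> gadget_edges M' H" for e
  proof -
    have "e \<in> edges (aux_graph t G V1 V2)"
      using that sub by (auto simp: gadget_edges_def)
    \<comment> \<open>An edge at \<open>BicliqueV1 H\<close> or \<open>BicliqueV2 H\<close> exists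
      only if \<open>H\<close> is also a biclique, which is excluded; so only edges at
      \<open>CliqueV H\<close> remain.\<close>
    then show ?thesis
      using that cliques_disjoint_bicliques[OF t H]
      by (cases rule: aux_edge_cases) (auto simp: gadget_edges_def)
  qed
  then have eq: "gadget_edges M' H = {e \<in> M'. CliqueV H \<in> e}"
    by (auto simp: gadget_edges_def)
  have "CliqueV H \<in> verts (aux_graph t G V1 V2)"
    using H by (simp add: aux_graph_def)
  then have "lower_cap t G (CliqueV H) \<le> degree M' (CliqueV H) \<and>
      degree M' (CliqueV H) \<le> upper_cap t G (CliqueV H)"
    using M' unfolding lb_matching_def by blast
  then have "card (gadget_edges M' H) = 2"
    unfolding eq by (simp add: degree_def)
  then obtain e1 e2 where e: "gadget_edges M' H = {e1, e2}" "e1 \<noteq> e2"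
    by (meson card_2_iff)
  then obtain x y where xy: "x \<in> verts H" "y \<in> verts H"
    "e1 = {Orig x, CliqueV H}" "e2 = {Orig y, CliqueV H}"
    using form by (metis insertI1 insertI2)
  with e have "x \<noteq> y" by auto
  moreover have "{x, y} \<in> edges H"
    using H xy \<open>x \<noteq> y\<close> by (auto simp: cliques_def complete_graph_def)
  ultimately show ?thesis using that e xy by blast
qed

text \<open>The capacity intervals \<open>[1,1]\<close> select exactly one vertex from each colour
  class, and vertices in opposite classes are adjacent.\<close>

lemma biclique_gadget:
  assumes t: "t \<ge> 2"
    and M': "lb_matching (aux_graph t G V1 V2) (lower_cap t G) (upper_cap t G) M'"
    and H: "H \<in> bicliques t G"
    and V: "complete_bipartite t H (V1 H) (V2 H)"
  obtains x y where "{x, y} \<in> edges H"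
    "gadget_edges M' H = {{Orig x, BicliqueV1 H}, {Orig y, BicliqueV2 H}}"
proof -
  have sub: "M' \<subseteq> edges (aux_graph t G V1 V2)"
    using M' by (simp add: lb_matching_def)
  have noclique: "H \<notin> cliques t G"
    using cliques_disjoint_bicliques[OF t] H by blast
  have form: "(\<exists>v\<in>V1 H. e = {Orig v, BicliqueV1 H}) \<or> (\<exists>v\<in>V2 H. e = {Orig v, BicliqueV2 H})"
    if "e \<in> gadget_edges M' H" for e
  proof -
    have "e \<in> edges (aux_graph t G V1 V2)"
      using that sub by (auto simp: gadget_edges_def)
    then show ?thesis
      using that noclique
      by (cases rule: aux_edge_cases) (auto simp: gadget_edges_def)
  qed
  then have eq: "gadget_edges M' H = {e \<in> M'. BicliqueV1 H \<in> e} \<union> {e \<in> M'. BicliqueV2 H \<in> e}"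
    by (auto simp: gadget_edges_def)
  have "BicliqueV1 H \<in> verts (aux_graph t G V1 V2)" "BicliqueV2 H \<in> verts (aux_graph t G V1 V2)"
    using H by (simp_all add: aux_graph_def)
  then have "lower_cap t G z \<le> degree M' z \<and> degree M' z \<le> upper_cap t G z"
    if "z \<in> {BicliqueV1 H, BicliqueV2 H}" for z
    using M' that unfolding lb_matching_def by blast
  from this[of "BicliqueV1 H"] this[of "BicliqueV2 H"]
  have "card {e \<in> M'. BicliqueV1 H \<in> e} = 1" "card {e \<in> M'. BicliqueV2 H \<in> e} = 1"
    by (simp_all add: degree_def)
  then obtain e1 e2 where e: "{e \<in> M'. BicliqueV1 H \<in> e} = {e1}" "{e \<in> M'. BicliqueV2 H \<in> e} = {e2}"
    by (meson card_1_singletonE)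
  then have gad: "gadget_edges M' H = {e1, e2}"
    using eq by auto
  have mem: "BicliqueV1 H \<in> e1" "BicliqueV2 H \<in> e2"
    using e by auto
  obtain x where x: "x \<in> V1 H" "e1 = {Orig x, BicliqueV1 H}"
    using form[of e1] gad mem by auto
  obtain y where y: "y \<in> V2 H" "e2 = {Orig y, BicliqueV2 H}"
    using form[of e2] gad mem by auto
  have "{x, y} \<in> edges H"
    using V x y by (auto simp: complete_bipartite_def)
  with that gad x y show ?thesis by blast
qed

text \<open>The gadget edges weigh \<open>r H x + r H y\<close>, which the potential turns into
  \<open>w {x, y}\<close>. The second conjunct keeps every original vertex covered by the gadget
  covered after the replacement; the degree bound will rest on it.\<close>

lemma gadget_replacement:
  assumes "t \<ge> 2"
    and "lb_matching (aux_graph t G V1 V2) (lower_cap t G) (upper_cap t G) M'"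
    and "H \<in> forbidden t G"
    and pot: "potential w H (r H)"
    and "H \<in> bicliques t G \<Longrightarrow> complete_bipartite t H (V1 H) (V2 H)"
  shows "\<exists>e\<in>edges H. sum (aux_weight w r) (gadget_edges M' H) = w e \<and>
           (\<forall>g\<in>gadget_edges M' H. \<forall>v. Orig v \<in> g \<longrightarrow> v \<in> e)"
  using assms(3) unfolding forbidden_def
proof
  assume "H \<in> cliques t G"
  then obtain x y where xy: "x \<noteq> y" "{x, y} \<in> edges H"
    and gad: "gadget_edges M' H = {{Orig x, CliqueV H}, {Orig y, CliqueV H}}"
    using clique_gadget[OF assms(1,2)] by blast
  \<comment> \<open>The sum ranges over a set, so both weights are counted only if the two edges
    differ.\<close>
  have "{Orig x, CliqueV H} \<noteq> {Orig y, CliqueV H}"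
    using xy by (auto simp: doubleton_eq_iff)
  then have "sum (aux_weight w r) (gadget_edges M' H) = w {x, y}"
    using pot xy unfolding gad by (simp add: aux_weight_new potential_def)
  then show ?thesis
    using xy(2) by (intro bexI[of _ "{x, y}"]) (auto simp: gad)
next
  assume "H \<in> bicliques t G"
  then obtain x y where xy: "{x, y} \<in> edges H"
    and gad: "gadget_edges M' H = {{Orig x, BicliqueV1 H}, {Orig y, BicliqueV2 H}}"
    using biclique_gadget[OF assms(1,2)] assms(5) by blast
  have "{Orig x, BicliqueV1 H} \<noteq> {Orig y, BicliqueV2 H}"
    by (auto simp: doubleton_eq_iff)
  then have "sum (aux_weight w r) (gadget_edges M' H) = w {x, y}"
    using pot xy unfolding gad by (simp add: aux_weight_new potential_def)
  then show ?thesis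
    using xy by (intro bexI[of _ "{x, y}"]) (auto simp: gad)
qed

section \<open>Splitting the auxiliary matching and its weight\<close>

lemma aux_edges_decomp:
  assumes "M' \<subseteq> edges (aux_graph t G V1 V2)"
  shows "M' = (`) Orig ` {e \<in> edges G. Orig ` e \<in> M'} \<union> (\<Union>H\<in>forbidden t G. gadget_edges M' H)"
proof (rule set_eqI, rule iffI)
  fix g assume g: "g \<in> M'"
  then have "g \<in> edges (aux_graph t G V1 V2)" using assms by blast
  then show "g \<in> (`) Orig ` {e \<in> edges G. Orig ` e \<in> M'} \<union> (\<Union>H\<in>forbidden t G. gadget_edges M' H)"
    using g by (cases rule: aux_edge_cases) (auto simp: gadget_edges_def forbidden_def)
qed (auto simp: gadget_edges_def)

text \<open>Serves to make \<open>M'\<close> finite: \<open>sum\<close> over an infinite set is 0 by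
  convention, and the weight could not be split. As \<open>V1\<close> and \<open>V2\<close> are
  arbitrary functions, their values on bicliques must be assumed to lie in \<open>G\<close>.\<close>

lemma finite_aux_edges:
  assumes "simple_graph G"
    and "\<And>H. H \<in> bicliques t G \<Longrightarrow> V1 H \<subseteq> verts G \<and> V2 H \<subseteq> verts G"
  shows "finite (edges (aux_graph t G V1 V2))"
proof (rule finite_subset)
  have fin: "finite (cliques t G)" "finite (bicliques t G)"
    using finite_forbidden[OF assms(1), of t] by (auto simp: forbidden_def)
  show "finite (Pow (verts (aux_graph t G V1 V2)))"
    using assms(1) fin by (simp add: aux_graph_def simple_graph_def)
  show "edges (aux_graph t G V1 V2) \<subseteq> Pow (verts (aux_graph t G V1 V2))"
  proof
    fix e assume "e \<in> edges (aux_graph t G V1 V2)"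
    then show "e \<in> Pow (verts (aux_graph t G V1 V2))"
    proof (cases rule: aux_edge_cases)
      case (orig e')
      then show ?thesis
        using assms(1) by (simp add: aux_graph_def simple_graph_def le_supI1 image_mono)
    next
      case (clique v H)
      then show ?thesis by (auto simp: aux_graph_def cliques_def subgraph_def)
    next
      case (biclique1 v H)
      then have "v \<in> verts G" using assms(2)[OF biclique1(1)] by blast
      then show ?thesis using biclique1 by (simp add: aux_graph_def)
    next
      case (biclique2 v H)
      then have "v \<in> verts G" using assms(2)[OF biclique2(1)] by blast
      then show ?thesis using biclique2 by (simp add: aux_graph_def)
    qed
  qed
qed

text \<open>An auxiliary edge contains at most one new vertex, and that vertex determines its
  forbidden subgraph.\<close>

lemma gadget_edges_disjoint:
  assumes "M' \<subseteq> edges (aux_graph t G V1 V2)" "H \<noteq> K"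
  shows "gadget_edges M' H \<inter> gadget_edges M' K = {}"
proof -
  have False if g: "g \<in> gadget_edges M' H" "g \<in> gadget_edges M' K" for g
  proof -
    have "g \<in> edges (aux_graph t G V1 V2)"
      using g(1) assms(1) by (auto simp: gadget_edges_def)
    then show False
      using g assms(2) by (cases rule: aux_edge_cases) (auto simp: gadget_edges_def)
  qed
  then show ?thesis by blast
qed

lemma sum_aux_weight:
  assumes "simple_graph G" "M' \<subseteq> edges (aux_graph t G V1 V2)"
    and "finite M'"
  shows "sum (aux_weight w r) M' = sum w {e \<in> edges G. Orig ` e \<in> M'} +
           (\<Sum>H\<in>forbidden t G. sum (aux_weight w r) (gadget_edges M' H))"
proof -
  let ?O = "{e \<in> edges G. Orig ` e \<in> M'}"
  have gfin: "finite (gadget_edges M' H)" for H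
    using assms(3) by (simp add: gadget_edges_def)
  have "sum (aux_weight w r) M' =
      sum (aux_weight w r) ((`) Orig ` ?O) +
      sum (aux_weight w r) (\<Union>H\<in>forbidden t G. gadget_edges M' H)"
    by (subst aux_edges_decomp[OF assms(2)], rule sum.union_disjoint)
      (auto simp: gadget_edges_def assms finite_edges finite_forbidden)
  also have "sum (aux_weight w r) ((`) Orig ` ?O) = sum w ?O"
    \<comment> \<open>Taking images under the injective \<open>Orig\<close> is itself injective, so
      no original edge is merged with another.\<close>
    by (subst sum.reindex) (auto simp: inj_on_def inj_image_eq_iff aux_weight_Orig)
  also have "sum (aux_weight w r) (\<Union>H\<in>forbidden t G. gadget_edges M' H) =
      (\<Sum>H\<in>forbidden t G. sum (aux_weight w r) (gadget_edges M' H))"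
    using assms gfin gadget_edges_disjoint[OF assms(2)]
    by (intro sum.UNION_disjoint) (auto simp: finite_forbidden)
  finally show ?thesis .
qed

text \<open>Only vertices of degree \<open>t + 1\<close> can exceed the bound \<open>t\<close>, and
  removing a single incident edge repairs each of them.\<close>

lemma t_matching_complement:
  assumes "simple_graph G"
    and "\<forall>v\<in>verts G. degree (edges G) v \<le> t + 1"
    and "\<And>v. v \<in> verts G \<Longrightarrow> degree (edges G) v = t + 1 \<Longrightarrow> \<exists>e\<in>M. v \<in> e"
    and "M \<subseteq> edges G"
  shows "t_matching t G (edges G - M)"
  unfolding t_matching_def
proof (intro conjI ballI)
  fix v assume v: "v \<in> verts G"
  let ?E = "{e \<in> edges G. v \<in> e}" and ?C = "{e \<in> edges G - M. v \<in> e}"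
  have fin: "finite ?E" using finite_edges[OF assms(1)] by simp
  have le: "card ?C \<le> card ?E" by (rule card_mono[OF fin]) auto
  have "card ?C < t + 1"
  proof (cases "degree (edges G) v = t + 1")
    case True
    then obtain e where "e \<in> M" "v \<in> e" using assms(3) v by blast
    then have "?C \<subset> ?E" using assms(4) by blast
    then have "card ?C < card ?E" by (rule psubset_card_mono[OF fin])
    then show ?thesis using True by (simp add: degree_def)
  next
    case False
    then show ?thesis using le assms(2) v by (fastforce simp: degree_def)
  qed
  then show "degree (edges G - M) v \<le> t" by (simp add: degree_def)
qed auto

section \<open>The covering co-\<open>t\<close>-matching obtained from \<open>M'\<close>\<close>

theorem theorem3:
  fixes t :: nat and G :: "'v ugraph" and w :: "'v set \<Rightarrow> real"
    and r :: "'v ugraph \<Rightarrow> 'v \<Rightarrow> real" and V1 V2 :: "'v ugraph \<Rightarrow> 'v set"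
  assumes "t \<ge> 3"
    and "simple_graph G"
    and "\<forall>v \<in> verts G. 1 \<le> degree (edges G) v \<and> degree (edges G) v \<le> t + 1"
    and "\<forall>e \<in> edges G. 0 \<le> w e"
    and "\<forall>H \<in> forbidden t G. vertex_induced w H"
    and "pairwise (\<lambda>H K. verts H \<inter> verts K = {}) (forbidden t G)"
    and "\<forall>H \<in> forbidden t G. potential w H (r H)"
    and "\<forall>H \<in> bicliques t G. complete_bipartite t H (V1 H) (V2 H)"
  shows "\<forall>M'. lb_matching (aux_graph t G V1 V2) (lower_cap t G) (upper_cap t G) M' \<longrightarrow>
           (\<exists>M. covering_co_t_matching t G M \<and> sum w M \<le> sum (aux_weight w r) M')"
proof (intro allI impI)
  fix M'
  assume M': "lb_matching (aux_graph t G V1 V2) (lower_cap t G) (upper_cap t G) M'"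
  let ?F = "forbidden t G" and ?O = "{e \<in> edges G. Orig ` e \<in> M'}"
  have sub: "M' \<subseteq> edges (aux_graph t G V1 V2)"
    using M' by (simp add: lb_matching_def)
  have V: "V1 H \<subseteq> verts G \<and> V2 H \<subseteq> verts G" if "H \<in> bicliques t G" for H
  proof -
    have "verts H = V1 H \<union> V2 H"
      using that assms(8) by (simp add: complete_bipartite_def)
    then show ?thesis using that by (simp add: bicliques_def subgraph_def)
  qed
  have finM': "finite M'"
    using sub finite_aux_edges[OF assms(2) V] by (rule finite_subset)
  have "\<forall>H\<in>?F. \<exists>e. e \<in> edges H \<and> sum (aux_weight w r) (gadget_edges M' H) = w e \<and>
      (\<forall>g\<in>gadget_edges M' H. \<forall>v. Orig v \<in> g \<longrightarrow> v \<in> e)"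
    using gadget_replacement[OF _ M', of _ w r] assms(1,7,8) by (simp add: Bex_def)
  \<comment> \<open>\<open>f H\<close> is the replacement edge chosen for the gadget of
    \<open>H\<close>.\<close>
  then obtain f where f: "\<And>H. H \<in> ?F \<Longrightarrow> f H \<in> edges H"
      "\<And>H. H \<in> ?F \<Longrightarrow> sum (aux_weight w r) (gadget_edges M' H) = w (f H)"
      "\<And>H g v. H \<in> ?F \<Longrightarrow> g \<in> gadget_edges M' H \<Longrightarrow> Orig v \<in> g \<Longrightarrow> v \<in> f H"
    by metis
  have fG: "f H \<in> edges G" if "H \<in> ?F" for H
    using f(1)[OF that] that
    by (auto simp: forbidden_def cliques_def bicliques_def subgraph_def)
  define M where "M = ?O \<union> f ` ?F"
  have MG: "M \<subseteq> edges G" using fG by (auto simp: M_def)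
  have "\<exists>e\<in>M. v \<in> e" if "v \<in> verts G" "degree (edges G) v = t + 1" for v
  proof -
    have "Orig v \<in> verts (aux_graph t G V1 V2)"
      using that by (simp add: aux_graph_def)
    \<comment> \<open>The lower capacity is 1 exactly at the vertices of degree
      \<open>t + 1\<close>, so \<open>M'\<close> has an edge there.\<close>
    then have "lower_cap t G (Orig v) \<le> degree M' (Orig v)"
      using M' unfolding lb_matching_def by blast
    then have "0 < card {g \<in> M'. Orig v \<in> g}"
      using that by (simp add: degree_def)
    then have "{g \<in> M'. Orig v \<in> g} \<noteq> {}"
      unfolding card_gt_0_iff by (rule conjunct1)
    then obtain g where g: "g \<in> M'" "Orig v \<in> g" by blast
    then consider e where "e \<in> ?O" "g = Orig ` e" | H where "H \<in> ?F" "g \<in> gadget_edges M' H"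
      using subsetD[OF equalityD1[OF aux_edges_decomp[OF sub]], of g] by blast
    then show ?thesis
    proof cases
      case 1
      then show ?thesis using g by (auto simp: M_def)
    next
      case 2
      \<comment> \<open>A gadget edge at \<open>v\<close> is itself discarded, but
        \<open>f H\<close> still contains \<open>v\<close>.\<close>
      then show ?thesis using f(3) g by (auto simp: M_def)
    qed
  qed
  then have "co_t_matching t G M"
    using t_matching_complement[OF assms(2)] assms(3) MG by (simp add: co_t_matching_def)
  \<comment> \<open>Every forbidden \<open>H\<close> loses its own edge \<open>f H\<close>, which
    belongs to \<open>M\<close>.\<close>
  moreover have "\<forall>H\<in>?F. \<not> edges H \<subseteq> edges G - M"
    using f(1) by (auto simp: M_def)
  ultimately have "covering_co_t_matching t G M"
    by (simp add: covering_co_t_matching_def)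
  moreover have "sum w M \<le> sum (aux_weight w r) M'"
  proof -
    have fin: "finite ?O" "finite ?F"
      using finite_edges[OF assms(2)] finite_forbidden[OF assms(2)] by auto
    have "sum w M + sum w (?O \<inter> f ` ?F) = sum w ?O + sum w (f ` ?F)"
      unfolding M_def using fin by (intro sum.union_inter) auto
    moreover have "0 \<le> sum w (?O \<inter> f ` ?F)"
      using assms(4) by (intro sum_nonneg) auto
    \<comment> \<open>Passing from the index set to the image can only drop repeated nonnegative
      terms.\<close>
    moreover have "sum w (f ` ?F) \<le> (\<Sum>H\<in>?F. w (f H))"
      using sum_image_le[of ?F w f] fin fG assms(4) by (simp add: comp_def)
    moreover have "(\<Sum>H\<in>?F. w (f H)) = (\<Sum>H\<in>?F. sum (aux_weight w r) (gadget_edges M' H))"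
      using f(2) by simp
    ultimately show ?thesis
      using sum_aux_weight[OF assms(2) sub finM', of w r] by linarith
  qed
  ultimately show "\<exists>M. covering_co_t_matching t G M \<and> sum w M \<le> sum (aux_weight w r) M'"
    by blast
qed

end
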